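(* Let $\Omega\subseteq\mathbb{R}^n$ be closed, let $\Xi\subseteq\Omega$ be a Borel set, let $g,h_0,\dots,h_m:\Omega\to\mathbb{R}$ be measurable with $h_0\equiv 1$, let $\mathbf{q}=(q_0,\dots,q_m)$ with $q_0=1$, and let $\mathcal{P}_0$ be a convex set of probability measures on $\Omega$. Put $$\mathcal{P}(\mathbf{q})=\Big\{\mathbb{P}\in\mathcal{P}_0:\int_\Omega h_j\,\mathrm{d}\mathbb{P}=q_j,\ j=0,\dots,m\Big\}.$$ Suppose that: (A1) $g$ is bounded on $\Omega$; (A2) there exists $\epsilon>0$ such that $\inf_{\mathbb{P}\in\mathcal{P}(\mathbf{q})}\mathbb{P}(X\in\Xi)\ge\epsilon$; (A3) $\mathbf{q}$ lies in the interior of the moment cone $\mathcal{Q}_{\mathcal P}$. Then the optimal value of the primal problem $$\sup_{\mathbb{P}\in\mathcal{P}(\mathbf{q})}\mathbb{E}_{\mathbb{P}}[g(X)\mid X\in\Xi]$$ is finite and equals the optimal value of the dual problem $$\begin{aligned}\inf_{\lambda_0,\dots,\lambda_{m+1}\in\mathbb{R}}\ &\lambda_{m+1}\\ \text{s.t. }\ &\sum_{j=0}^m\lambda_jq_j\le 0,\\ &\sum_{j=0}^{m+1}\lambda_jh_j(x)-g(x)\mathbf{1}_{\Xi}(x)\in\mathcal{A}^*,\end{aligned}$$ where $h_{m+1}:=\mathbf{1}_\Xi$ and $\mathcal{A}^*$ is the dual cone of the cone $\mathcal{A}$ of measures generated by $\mathcal{P}_0$.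
   Context: $X$ is the random vector with law $\mathbb{P}$ on $\Omega$; $\mathbf{1}_\Xi$ is the indicator function of $\Xi$. The conditional expectation is $\mathbb{E}_{\mathbb{P}}[g(X)\mid X\in\Xi]=\mathbb{E}_{\mathbb{P}}[g(X)\mathbf{1}_\Xi(X)]/\mathbb{E}_{\mathbb{P}}[\mathbf{1}_\Xi(X)]$, for $\mathbb{P}(X\in\Xi)>0$. The functions $h_j$ are integrable with respect to all measures considered, and $\mathcal{P}(\mathbf{q})$ is nonempty. $\mathcal{A}$ is the convex cone of nonnegative measures generated by $\mathcal{P}_0$, i.e. $\mathcal{A}=\{c\,\mathbb{P}:c\ge0,\ \mathbb{P}\in\mathcal{P}_0\}$. The moment cone is $\mathcal{Q}_{\mathcal P}=\{(\int h_0\,\mathrm{d}\rho,\dots,\int h_m\,\mathrm{d}\rho):\rho\in\mathcal{A}\}\subseteq\mathbb{R}^{m+1}$. The dual cone is $\mathcal{A}^*=\{h\in\mathcal{H}:\int_\Omega h\,\mathrm{d}\rho\ge0\ \text{for all }\rho\in\mathcal{A}\}$, where $\mathcal{H}$ is the linear space of functions spanned by $h_0,\dots,h_m$, $g$, $\mathbf{1}_\Xi$ and $g\mathbf{1}_\Xi$. For example, if $\mathcal{P}_0$ is the set of all probability measures on $\Omega$, membership in $\mathcal{A}^*$ means pointwise nonnegativity on $\Omega$. *)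

theory Defs
  imports "HOL-Probability.Probability"
begin

text \<open>
  A function on \<open>\<Omega>\<close> is represented by a total function of which only the values
  on \<open>\<Omega>\<close> matter; a measure on \<open>\<Omega>\<close> is a measure on the Borel sigma-algebra of the
  subspace \<open>\<Omega>\<close>. The moment functions \<open>h\<^sub>0, \<dots>, h\<^sub>m\<close> are indexed by an arbitrary
  finite type \<open>'k\<close> with \<open>m + 1\<close> elements, so that \<open>real ^ 'k\<close> is \<open>(m + 1)\<close>-dimensional
  real space.
\<close>

definition prob_measures_on :: "(real ^ 'n) set \<Rightarrow> (real ^ 'n) measure set" where
  "prob_measures_on \<Omega> =
     {P. prob_space P \<and> sets P = sets (restrict_space borel \<Omega>)}"

definition mix_measure :: "real \<Rightarrow> 'a measure \<Rightarrow> 'a measure \<Rightarrow> 'a measure" where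
  "mix_measure t P Q =
     measure_of (space P) (sets P)
       (\<lambda>A. ennreal t * emeasure P A + ennreal (1 - t) * emeasure Q A)"

lemma emeasure_mix_measure:
  assumes "sets Q = sets P" "A \<in> sets P"
  shows "emeasure (mix_measure t P Q) A =
           ennreal t * emeasure P A + ennreal (1 - t) * emeasure Q A"
  unfolding mix_measure_def
proof (rule emeasure_measure_of_sigma)
  show "sigma_algebra (space P) (sets P)" ..
  show "positive (sets P) (\<lambda>A. ennreal t * emeasure P A + ennreal (1 - t) * emeasure Q A)"
    by (simp add: positive_def)
  show "countably_additive (sets P)
          (\<lambda>A. ennreal t * emeasure P A + ennreal (1 - t) * emeasure Q A)"
  proof (rule countably_additiveI)
    fix B :: "nat \<Rightarrow> 'a set"
    assume B: "range B \<subseteq> sets P" "disjoint_family B"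
    then have "(\<Sum>i. emeasure P (B i)) = emeasure P (\<Union> (range B))"
      and "(\<Sum>i. emeasure Q (B i)) = emeasure Q (\<Union> (range B))"
      using assms(1) by (auto intro!: suminf_emeasure)
    then show "(\<Sum>i. ennreal t * emeasure P (B i) + ennreal (1 - t) * emeasure Q (B i)) =
        ennreal t * emeasure P (\<Union> (range B)) + ennreal (1 - t) * emeasure Q (\<Union> (range B))"
      by (simp add: suminf_add [symmetric])
  qed
qed (fact assms(2))

lemma sets_mix_measure: "sets (mix_measure t P Q) = sets P"
  by (simp add: mix_measure_def)

definition convex_measures :: "'a measure set \<Rightarrow> bool" where
  "convex_measures \<P> \<longleftrightarrow> (\<forall>P\<in>\<P>. \<forall>Q\<in>\<P>. \<forall>t\<in>{0..1}. mix_measure t P Q \<in> \<P>)"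

definition measure_cone :: "'a measure set \<Rightarrow> 'a measure set" where
  "measure_cone \<P> = {scale_measure (ennreal c) P | c P. 0 \<le> c \<and> P \<in> \<P>}"

definition moment_vector :: "('k::finite \<Rightarrow> 'a \<Rightarrow> real) \<Rightarrow> 'a measure \<Rightarrow> real ^ 'k" where
  "moment_vector h \<rho> = (\<chi> j. \<integral>x. h j x \<partial>\<rho>)"

definition moment_cone :: "'a measure set \<Rightarrow> ('k::finite \<Rightarrow> 'a \<Rightarrow> real) \<Rightarrow> (real ^ 'k) set" where
  "moment_cone \<P> h = moment_vector h ` measure_cone \<P>"

definition moment_measures ::
    "'a measure set \<Rightarrow> ('k::finite \<Rightarrow> 'a \<Rightarrow> real) \<Rightarrow> real ^ 'k \<Rightarrow> 'a measure set" where
  "moment_measures \<P> h q = {P \<in> \<P>. \<forall>j. (\<integral>x. h j x \<partial>P) = q $ j}"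

definition cond_expect :: "'a measure \<Rightarrow> ('a \<Rightarrow> real) \<Rightarrow> 'a set \<Rightarrow> real" where
  "cond_expect P g \<Xi> =
     (\<integral>x. g x * indicator \<Xi> x \<partial>P) / (\<integral>x. indicator \<Xi> x \<partial>P)"

definition function_span ::
    "'a set \<Rightarrow> ('k::finite \<Rightarrow> 'a \<Rightarrow> real) \<Rightarrow> ('a \<Rightarrow> real) \<Rightarrow> 'a set \<Rightarrow> ('a \<Rightarrow> real) set" where
  "function_span \<Omega> h g \<Xi> =
     {f. \<exists>(a :: real ^ 'k) b c d. \<forall>x\<in>\<Omega>.
           f x = (\<Sum>j\<in>UNIV. a $ j * h j x) + b * g x + c * indicator \<Xi> x
                   + d * (g x * indicator \<Xi> x)}"

definition dual_cone :: "('a \<Rightarrow> real) set \<Rightarrow> 'a measure set \<Rightarrow> ('a \<Rightarrow> real) set" where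
  "dual_cone \<H> \<A> = {f \<in> \<H>. \<forall>\<rho>\<in>\<A>. 0 \<le> (\<integral>x. f x \<partial>\<rho>)}"

definition primal_value ::
    "'a measure set \<Rightarrow> ('k::finite \<Rightarrow> 'a \<Rightarrow> real) \<Rightarrow> real ^ 'k \<Rightarrow> ('a \<Rightarrow> real) \<Rightarrow> 'a set \<Rightarrow> ereal"
  where
  "primal_value \<P> h q g \<Xi> = (SUP P \<in> moment_measures \<P> h q. ereal (cond_expect P g \<Xi>))"

text \<open>
  A dual variable \<open>(\<lambda>\<^sub>0, \<dots>, \<lambda>\<^bsub>m+1\<^esub>)\<close> is split into the vector \<open>l\<close> of its
  first \<open>m + 1\<close> entries and its last entry \<open>\<mu>\<close>, the multiplier of the indicator
  function of \<open>\<Xi>\<close>.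
\<close>

definition dual_feasible ::
    "'a set \<Rightarrow> 'a measure set \<Rightarrow> ('k::finite \<Rightarrow> 'a \<Rightarrow> real) \<Rightarrow> real ^ 'k \<Rightarrow> ('a \<Rightarrow> real) \<Rightarrow>
      'a set \<Rightarrow> ((real ^ 'k) \<times> real) set"
  where
  "dual_feasible \<Omega> \<P> h q g \<Xi> =
     {(l, \<mu>).
        (\<Sum>j\<in>UNIV. l $ j * q $ j) \<le> 0 \<and>
        (\<lambda>x. (\<Sum>j\<in>UNIV. l $ j * h j x) + \<mu> * indicator \<Xi> x - g x * indicator \<Xi> x)
          \<in> dual_cone (function_span \<Omega> h g \<Xi>) (measure_cone \<P>)}"

definition dual_value ::
    "'a set \<Rightarrow> 'a measure set \<Rightarrow> ('k::finite \<Rightarrow> 'a \<Rightarrow> real) \<Rightarrow> real ^ 'k \<Rightarrow> ('a \<Rightarrow> real) \<Rightarrow>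
      'a set \<Rightarrow> ereal"
  where
  "dual_value \<Omega> \<P> h q g \<Xi> = (INF (l, \<mu>) \<in> dual_feasible \<Omega> \<P> h q g \<Xi>. ereal \<mu>)"

end

theory Submission
  imports Defs
begin

text \<open>
  The fractional objective disappears once its optimal value \<open>V\<close> is known: \<open>V\<close> bounds every
  conditional expectation exactly when \<open>\<integral>(g - V) 1\<^sub>\<Xi> \<partial>P \<le> 0\<close> for every admissible \<open>P\<close>, because
  the conditioning event has positive probability. What remains is a linear moment problem.
  Integrals are affine along mixtures, so the pairs consisting of the moment vector of a measure
  and its integral of \<open>(g - V) 1\<^sub>\<Xi>\<close> form a convex cone as the measure runs through the cone
  generated by \<open>\<P>\<^sub>0\<close>. Since \<open>h\<^sub>0 = 1\<close> and \<open>q\<^sub>0 = 1\<close>, every pair in this cone over \<open>q\<close> comes from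
  an admissible probability measure, so the open ray above \<open>(q, 0)\<close> misses the cone. A
  hyperplane separating the two is not vertical because \<open>q\<close> is interior to the moment cone; its
  slope is a vector of multipliers \<open>\<lambda>\<close> with \<open>\<lambda> \<bullet> q \<le> 0\<close> for which \<open>(\<lambda>, V)\<close> is
  dual feasible. This is \<open>convex_cone_multiplier\<close>, applied in \<open>dual_feasible_of_bound\<close>; in
  particular the dual optimum is attained. The opposite inequality integrates
  the dual constraint against an admissible \<open>P\<close> (\<open>dual_feasible_imp_bound\<close>).
\<close>

section \<open>Integration against mixtures and multiples\<close>

lemma nn_integral_mix_measure:
  assumes QP: "sets Q = sets P" and f: "f \<in> borel_measurable P"
  shows "(\<integral>\<^sup>+x. f x \<partial>mix_measure t P Q) =
           ennreal t * (\<integral>\<^sup>+x. f x \<partial>P) + ennreal (1 - t) * (\<integral>\<^sup>+x. f x \<partial>Q)"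
proof -
  note [simp] = sets_mix_measure sets_eq_imp_space_eq[OF sets_mix_measure]
    sets_eq_imp_space_eq[OF QP] QP
  have mix: "borel_measurable (mix_measure t P Q) = borel_measurable P"
    by (rule measurable_cong_sets) auto
  have mQ: "borel_measurable Q = borel_measurable P"
    by (rule measurable_cong_sets) auto
  from f show ?thesis
  proof induction
    case (cong f g)
    then show ?case by (simp cong: nn_integral_cong_simp)
  next
    case (set A)
    then show ?case by (simp add: emeasure_mix_measure)
  next
    case (mult u c)
    then show ?case by (simp add: nn_integral_cmult mix mQ distrib_left mult.left_commute)
  next
    case (add u v)
    then show ?case by (simp add: nn_integral_add mix mQ distrib_left ac_simps)
  next
    case (seq U)
    have inc: "incseq (\<lambda>i. ennreal s * integral\<^sup>N M (U i))" for s M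
      using seq(3) by (intro incseq_SucI mult_left_mono nn_integral_mono)
        (auto simp: incseq_Suc_iff le_fun_def)
    show ?case
      using seq by (simp add: nn_integral_monotone_convergence_SUP mix mQ SUP_mult_left_ennreal
          image_comp ennreal_SUP_add[OF inc inc])
  qed
qed

text \<open>
  A mixture is defined by its values on sets, so its integrals are first computed for nonnegative
  functions, by approximation, and then for the positive and negative parts separately.
\<close>

lemma integral_mix_measure:
  fixes f :: "'a \<Rightarrow> real"
  assumes QP: "sets Q = sets P" and t: "0 \<le> t" "t \<le> 1"
    and P: "integrable P f" and Q: "integrable Q f"
  shows "(\<integral>x. f x \<partial>mix_measure t P Q) = t * (\<integral>x. f x \<partial>P) + (1 - t) * (\<integral>x. f x \<partial>Q)"
proof -
  obtain p p' where p: "0 \<le> p" "0 \<le> p'" "(\<integral>\<^sup>+x. f x \<partial>P) = ennreal p"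
      "(\<integral>\<^sup>+x. - f x \<partial>P) = ennreal p'" "integral\<^sup>L P f = p - p'" and m: "f \<in> borel_measurable P"
    using P by (rule integrableE)
  obtain r r' where r: "0 \<le> r" "0 \<le> r'" "(\<integral>\<^sup>+x. f x \<partial>Q) = ennreal r"
      "(\<integral>\<^sup>+x. - f x \<partial>Q) = ennreal r'" "integral\<^sup>L Q f = r - r'"
    using Q by (rule integrableE)
  have pos: "(\<integral>\<^sup>+x. f x \<partial>mix_measure t P Q) = ennreal (t * p + (1 - t) * r)"
    using m p r t by (simp add: nn_integral_mix_measure[OF QP] ennreal_mult ennreal_plus)
  have neg: "(\<integral>\<^sup>+x. - f x \<partial>mix_measure t P Q) = ennreal (t * p' + (1 - t) * r')"
    using m p r t by (simp add: nn_integral_mix_measure[OF QP] ennreal_mult ennreal_plus)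
  have "f \<in> borel_measurable (mix_measure t P Q)"
    using m by (simp add: measurable_cong_sets[OF sets_mix_measure refl])
  then have "integrable (mix_measure t P Q) f"
    using pos neg by (simp add: real_integrable_def)
  then have "(\<integral>x. f x \<partial>mix_measure t P Q) = (t * p + (1 - t) * r) - (t * p' + (1 - t) * r')"
    using p r t by (simp add: real_lebesgue_integral_def pos neg del: ennreal_plus)
  then show ?thesis
    by (simp add: p(5) r(5) algebra_simps)
qed

lemma integral_scale_measure:
  fixes f :: "'a \<Rightarrow> real"
  assumes c: "0 \<le> c" and P: "integrable P f"
  shows "(\<integral>x. f x \<partial>scale_measure (ennreal c) P) = c * (\<integral>x. f x \<partial>P)"
proof -
  obtain p p' where p: "0 \<le> p" "0 \<le> p'" "(\<integral>\<^sup>+x. f x \<partial>P) = ennreal p"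
      "(\<integral>\<^sup>+x. - f x \<partial>P) = ennreal p'" "integral\<^sup>L P f = p - p'" and m: "f \<in> borel_measurable P"
    using P by (rule integrableE)
  have pos: "(\<integral>\<^sup>+x. f x \<partial>scale_measure (ennreal c) P) = ennreal (c * p)"
    using m p c by (simp add: nn_integral_scale_measure ennreal_mult)
  have neg: "(\<integral>\<^sup>+x. - f x \<partial>scale_measure (ennreal c) P) = ennreal (c * p')"
    using m p c by (simp add: nn_integral_scale_measure ennreal_mult)
  have "f \<in> borel_measurable (scale_measure (ennreal c) P)"
    using m by (simp add: measurable_cong_sets[OF sets_scale_measure refl])
  then have "integrable (scale_measure (ennreal c) P) f"
    using pos neg by (simp add: real_integrable_def)
  then have "(\<integral>x. f x \<partial>scale_measure (ennreal c) P) = c * p - c * p'"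
    using p c by (simp add: real_lebesgue_integral_def pos neg)
  then show ?thesis
    by (simp add: p(5) algebra_simps)
qed

section \<open>Multipliers for a convex cone\<close>

text \<open>
  A cone lies on the nonpositive side of any hyperplane that bounds it, so separating \<open>C\<close> from
  the ray above \<open>(q, 0)\<close> gives a hyperplane through the origin. The interior assumption makes
  the coefficient \<open>b\<close> of the last coordinate nonzero: if \<open>b = 0\<close>, the linear form given by the
  remaining coefficients is nonpositive on all of \<open>fst ` C\<close> and nonnegative at the interior point
  \<open>q\<close>, hence zero.
\<close>

lemma convex_cone_multiplier:
  fixes C :: "('a::euclidean_space \<times> real) set"
  assumes "convex C" "cone C"
    and interior: "q \<in> interior (fst ` C)"
    and bound: "\<And>t. (q, t) \<in> C \<Longrightarrow> t \<le> 0"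
  obtains l where "l \<bullet> q \<le> 0" "\<And>r t. (r, t) \<in> C \<Longrightarrow> t \<le> l \<bullet> r"
proof -
  define T where "T = {q} \<times> {0::real<..}"
  have ne: "C \<noteq> {}" using interior interior_subset by fastforce
  have "convex T" unfolding T_def by (intro convex_Times) auto
  moreover have "T \<noteq> {}" unfolding T_def by (simp add: ex_gt_or_lt)
  moreover have "C \<inter> T = {}" using bound unfolding T_def by fastforce
  ultimately obtain w \<alpha> where w: "w \<noteq> 0" "\<And>x. x \<in> C \<Longrightarrow> w \<bullet> x \<le> \<alpha>" "\<And>x. x \<in> T \<Longrightarrow> \<alpha> \<le> w \<bullet> x"
    using separating_hyperplane_sets[of C T] \<open>convex C\<close> ne by metis
  obtain a b where ab: "w = (a, b)" by (cases w)
  have scale: "c *\<^sub>R x \<in> C" if "x \<in> C" "0 \<le> c" for x c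
    using that \<open>cone C\<close> by (simp add: cone_def)
  have "0 \<le> \<alpha>"
    using w(2)[of 0] ne scale[of _ 0] by fastforce
  have C: "w \<bullet> x \<le> 0" if "x \<in> C" for x
  proof (rule ccontr)
    assume "\<not> w \<bullet> x \<le> 0"
    then have pos: "0 < w \<bullet> x" by simp
    \<comment> \<open>The multiple of \<open>x\<close> at which the linear form takes the value \<open>\<alpha> + 1\<close>.\<close>
    have "w \<bullet> (((\<alpha> + 1) / (w \<bullet> x)) *\<^sub>R x) \<le> \<alpha>"
      using \<open>0 \<le> \<alpha>\<close> pos that by (intro w(2) scale) auto
    then show False using pos by simp
  qed
  have ray: "0 \<le> a \<bullet> q + b * t" if "0 < t" for t
    using w(3)[of "(q, t)"] \<open>0 \<le> \<alpha>\<close> that by (auto simp: ab T_def)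
  have "0 \<le> b"
  proof (rule ccontr)
    assume "\<not> 0 \<le> b"
    then have "b < 0" by simp
    \<comment> \<open>Far enough up the ray for the negative slope \<open>b\<close> to outweigh \<open>a \<bullet> q\<close>.\<close>
    define t where "t = (\<bar>a \<bullet> q\<bar> + 1) / (- b)"
    have "0 < t" using \<open>b < 0\<close> unfolding t_def by (intro divide_pos_pos) auto
    moreover have "b * t = - (\<bar>a \<bullet> q\<bar> + 1)" using \<open>b < 0\<close> by (simp add: t_def field_simps)
    ultimately show False using ray[of t] by linarith
  qed
  have aq: "0 \<le> a \<bullet> q"
  proof (rule field_le_epsilon)
    fix e :: real assume "0 < e"
    then have "b * (e / (b + 1)) \<le> e"
      using \<open>0 \<le> b\<close> by (simp add: field_simps)
    then show "0 \<le> a \<bullet> q + e"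
      using ray[of "e / (b + 1)"] \<open>0 < e\<close> \<open>0 \<le> b\<close> by simp
  qed
  have "b \<noteq> 0"
  proof
    assume "b = 0"
    then have "a \<noteq> 0" using w(1) ab by (simp add: zero_prod_def)
    obtain e where "0 < e" and e: "cball q e \<subseteq> fst ` C"
      using interior by (auto simp: mem_interior_cball)
    have "q + (e / norm a) *\<^sub>R a \<in> cball q e"
      using \<open>a \<noteq> 0\<close> \<open>0 < e\<close> by (simp add: dist_norm)
    then obtain s where "(q + (e / norm a) *\<^sub>R a, s) \<in> C" using e by force
    then have "a \<bullet> q + (e / norm a) * (a \<bullet> a) \<le> 0"
      using C[of "(q + (e / norm a) *\<^sub>R a, s)"] by (simp add: ab \<open>b = 0\<close> inner_add_right)
    moreover have "0 < (e / norm a) * (a \<bullet> a)"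
      using \<open>a \<noteq> 0\<close> \<open>0 < e\<close> by simp
    ultimately show False using aq by linarith
  qed
  then have "0 < b" using \<open>0 \<le> b\<close> by simp
  show thesis
  proof (rule that[of "(- 1 / b) *\<^sub>R a"])
    show "((- 1 / b) *\<^sub>R a) \<bullet> q \<le> 0" using aq \<open>0 < b\<close> by simp
    fix r t assume "(r, t) \<in> C"
    then have "a \<bullet> r + b * t \<le> 0" using C[of "(r, t)"] by (simp add: ab)
    then show "t \<le> ((- 1 / b) *\<^sub>R a) \<bullet> r" using \<open>0 < b\<close> by (simp add: field_simps)
  qed
qed

section \<open>Moments over a convex set of measures\<close>

lemma moment_vector_scale_measure:
  assumes "0 \<le> c" "\<And>j. integrable P (h j)"
  shows "moment_vector h (scale_measure (ennreal c) P) = c *\<^sub>R moment_vector h P"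
  using assms by (simp add: moment_vector_def vec_eq_iff integral_scale_measure)

lemma moment_measures_iff:
  "P \<in> moment_measures \<P> h q \<longleftrightarrow> P \<in> \<P> \<and> moment_vector h P = q"
  by (simp add: moment_measures_def moment_vector_def vec_eq_iff)

lemma convex_moment_image:
  fixes h :: "'k::finite \<Rightarrow> 'a \<Rightarrow> real" and f :: "'a \<Rightarrow> real"
  assumes conv: "convex_measures \<P>"
    and sets: "\<And>P Q. P \<in> \<P> \<Longrightarrow> Q \<in> \<P> \<Longrightarrow> sets Q = sets P"
    and h: "\<And>P j. P \<in> \<P> \<Longrightarrow> integrable P (h j)"
    and f: "\<And>P. P \<in> \<P> \<Longrightarrow> integrable P f"
  shows "convex ((\<lambda>P. (moment_vector h P, \<integral>x. f x \<partial>P)) ` \<P>)"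
proof (rule convexI, elim imageE)
  fix x y P Q and u v :: real
  assume uv: "0 \<le> u" "0 \<le> v" "u + v = 1" and P: "P \<in> \<P>" and Q: "Q \<in> \<P>"
    and x: "x = (moment_vector h P, \<integral>x. f x \<partial>P)" and y: "y = (moment_vector h Q, \<integral>x. f x \<partial>Q)"
  have v: "v = 1 - u" using uv by simp
  have mix: "(\<integral>x. k x \<partial>mix_measure u P Q) = u * (\<integral>x. k x \<partial>P) + v * (\<integral>x. k x \<partial>Q)"
    if "integrable P k" "integrable Q k" for k :: "'a \<Rightarrow> real"
    unfolding v using integral_mix_measure[OF sets[OF P Q], of u k] that uv by simp
  have "u *\<^sub>R x + v *\<^sub>R y = (moment_vector h (mix_measure u P Q), \<integral>x. f x \<partial>mix_measure u P Q)"
    using h f P Q by (simp add: x y mix moment_vector_def vec_eq_iff)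
  moreover have "mix_measure u P Q \<in> \<P>"
    using conv P Q uv by (simp add: convex_measures_def)
  ultimately show "u *\<^sub>R x + v *\<^sub>R y \<in> (\<lambda>P. (moment_vector h P, \<integral>x. f x \<partial>P)) ` \<P>"
    by (rule image_eqI)
qed

text \<open>
  Linear duality for moment problems. Constancy of \<open>h j0\<close> turns the normalisation \<open>q $ j0 = 1\<close>
  into a condition on the total mass: a multiple \<open>c P\<close> with moment vector \<open>q\<close> must have \<open>c = 1\<close>.
\<close>

lemma moment_multiplier:
  fixes h :: "'k::finite \<Rightarrow> 'a \<Rightarrow> real" and q :: "real ^ 'k" and f :: "'a \<Rightarrow> real"
  assumes conv: "convex_measures \<P>"
    and sets: "\<And>P Q. P \<in> \<P> \<Longrightarrow> Q \<in> \<P> \<Longrightarrow> sets Q = sets P"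
    and h: "\<And>P j. P \<in> \<P> \<Longrightarrow> integrable P (h j)"
    and f: "\<And>P. P \<in> \<P> \<Longrightarrow> integrable P f"
    and mass: "\<And>P. P \<in> \<P> \<Longrightarrow> (\<integral>x. h j0 x \<partial>P) = 1" and q: "q $ j0 = 1"
    and interior: "q \<in> interior (moment_cone \<P> h)"
    and bound: "\<And>P. P \<in> moment_measures \<P> h q \<Longrightarrow> (\<integral>x. f x \<partial>P) \<le> 0"
  obtains l where "l \<bullet> q \<le> 0" "\<And>P. P \<in> \<P> \<Longrightarrow> (\<integral>x. f x \<partial>P) \<le> l \<bullet> moment_vector h P"
proof -
  define S where "S = (\<lambda>P. (moment_vector h P, \<integral>x. f x \<partial>P)) ` \<P>"
  have hull: "cone hull S = {c *\<^sub>R x | c x. 0 \<le> c \<and> x \<in> S}"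
    by (rule cone_hull_expl)
  have "moment_cone \<P> h \<subseteq> fst ` (cone hull S)"
  proof
    fix r assume "r \<in> moment_cone \<P> h"
    then obtain c P where cP: "0 \<le> c" "P \<in> \<P>" "r = moment_vector h (scale_measure (ennreal c) P)"
      by (auto simp: moment_cone_def measure_cone_def)
    then have "r = fst (c *\<^sub>R (moment_vector h P, \<integral>x. f x \<partial>P))"
      by (simp add: moment_vector_scale_measure h)
    moreover have "c *\<^sub>R (moment_vector h P, \<integral>x. f x \<partial>P) \<in> cone hull S"
      using cP(1,2) unfolding S_def by (intro mem_cone_hull imageI)
    ultimately show "r \<in> fst ` (cone hull S)"
      by (rule image_eqI)
  qed
  then have int: "q \<in> interior (fst ` (cone hull S))"
    using interior interior_mono by blast
  have "t \<le> 0" if qt: "(q, t) \<in> cone hull S" for t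
  proof -
    obtain c P where cP: "0 \<le> c" "P \<in> \<P>" "q = c *\<^sub>R moment_vector h P" "t = c * (\<integral>x. f x \<partial>P)"
      using qt unfolding hull unfolding S_def by auto
    have "c = 1"
      using arg_cong[OF cP(3), of "\<lambda>v. v $ j0"] q mass[OF cP(2)] by (simp add: moment_vector_def)
    then show ?thesis
      using bound[of P] cP by (simp add: moment_measures_iff)
  qed
  moreover have "convex (cone hull S)"
    unfolding S_def by (intro convex_cone_hull convex_moment_image conv sets h f)
  ultimately obtain l where lq: "l \<bullet> q \<le> 0" and l: "\<And>r t. (r, t) \<in> cone hull S \<Longrightarrow> t \<le> l \<bullet> r"
    using convex_cone_multiplier[OF _ cone_cone_hull int] by blast
  have "(\<integral>x. f x \<partial>P) \<le> l \<bullet> moment_vector h P" if "P \<in> \<P>" for P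
    using that by (intro l hull_inc) (simp add: S_def)
  with lq show thesis by (rule that)
qed

section \<open>Primal bounds and dual feasibility\<close>

text \<open>
  What the duality argument asks of the data, for any class of measures on any space: finite
  integrals, and a positive probability of the conditioning event, which allows the denominator
  of the conditional expectation to be cleared.
\<close>

locale conditional_moment_problem =
  fixes \<Omega> \<Xi> :: "'a set" and g :: "'a \<Rightarrow> real" and h :: "'k::finite \<Rightarrow> 'a \<Rightarrow> real"
    and q :: "real ^ 'k" and \<P> :: "'a measure set"
  assumes integrable_h: "P \<in> \<P> \<Longrightarrow> integrable P (h j)"
    and integrable_ind: "P \<in> \<P> \<Longrightarrow> integrable P (indicator \<Xi> :: 'a \<Rightarrow> real)"
    and integrable_g_ind: "P \<in> \<P> \<Longrightarrow> integrable P (\<lambda>x. g x * indicator \<Xi> x)"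
    and prob_pos: "P \<in> moment_measures \<P> h q \<Longrightarrow> 0 < (\<integral>x. indicator \<Xi> x \<partial>P :: real)"
begin

lemma cond_expect_le_iff:
  assumes "P \<in> moment_measures \<P> h q"
  shows "cond_expect P g \<Xi> \<le> \<mu> \<longleftrightarrow>
           (\<integral>x. g x * indicator \<Xi> x \<partial>P) \<le> \<mu> * (\<integral>x. indicator \<Xi> x \<partial>P)"
  unfolding cond_expect_def using prob_pos[OF assms] by (simp add: pos_divide_le_eq)

lemma integrable_objective:
  assumes "P \<in> \<P>"
  shows "integrable P (\<lambda>x. g x * indicator \<Xi> x - \<mu> * indicator \<Xi> x)"
  by (intro Bochner_Integration.integrable_diff integrable_mult_right
      integrable_ind integrable_g_ind assms)

lemma integral_objective:
  assumes "P \<in> \<P>"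
  shows "(\<integral>x. g x * indicator \<Xi> x - \<mu> * indicator \<Xi> x \<partial>P) =
           (\<integral>x. g x * indicator \<Xi> x \<partial>P) - \<mu> * (\<integral>x. indicator \<Xi> x \<partial>P)"
  using integrable_g_ind[OF assms] integrable_ind[OF assms]
  by (subst Bochner_Integration.integral_diff) auto

lemma integrable_dual_constraint:
  assumes "P \<in> \<P>"
  shows "integrable P (\<lambda>x. (\<Sum>j\<in>UNIV. l $ j * h j x) + \<mu> * indicator \<Xi> x - g x * indicator \<Xi> x)"
  by (intro Bochner_Integration.integrable_diff Bochner_Integration.integrable_add
      Bochner_Integration.integrable_sum integrable_mult_right
      integrable_h integrable_ind integrable_g_ind assms)

lemma integral_dual_constraint:
  assumes "P \<in> \<P>"
  shows "(\<integral>x. (\<Sum>j\<in>UNIV. l $ j * h j x) + \<mu> * indicator \<Xi> x - g x * indicator \<Xi> x \<partial>P) =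
           l \<bullet> moment_vector h P + \<mu> * (\<integral>x. indicator \<Xi> x \<partial>P)
             - (\<integral>x. g x * indicator \<Xi> x \<partial>P)"
proof -
  have s: "integrable P (\<lambda>x. \<Sum>j\<in>UNIV. l $ j * h j x)"
    by (intro Bochner_Integration.integrable_sum integrable_mult_right integrable_h assms)
  have i: "integrable P (\<lambda>x. \<mu> * indicator \<Xi> x :: real)"
    by (intro integrable_mult_right integrable_ind assms)
  have "(\<integral>x. (\<Sum>j\<in>UNIV. l $ j * h j x) \<partial>P) = l \<bullet> moment_vector h P"
    using integrable_h[OF assms]
    by (subst Bochner_Integration.integral_sum) (auto simp: inner_vec_def moment_vector_def)
  then show ?thesis
    using s i integrable_g_ind[OF assms]
    by (simp add: Bochner_Integration.integral_diff Bochner_Integration.integral_add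
        Bochner_Integration.integrable_add)
qed

lemma dual_feasible_iff:
  "(l, \<mu>) \<in> dual_feasible \<Omega> \<P> h q g \<Xi> \<longleftrightarrow>
     l \<bullet> q \<le> 0 \<and>
     (\<forall>P\<in>\<P>. (\<integral>x. g x * indicator \<Xi> x \<partial>P) \<le>
               l \<bullet> moment_vector h P + \<mu> * (\<integral>x. indicator \<Xi> x \<partial>P))"
proof -
  let ?f = "\<lambda>x. (\<Sum>j\<in>UNIV. l $ j * h j x) + \<mu> * indicator \<Xi> x - g x * indicator \<Xi> x"
  have span: "?f \<in> function_span \<Omega> h g \<Xi>"
    unfolding function_span_def
    by (intro CollectI exI[of _ l] exI[of _ 0] exI[of _ \<mu>] exI[of _ "-1"]) simp
  have "(\<forall>\<rho>\<in>measure_cone \<P>. 0 \<le> (\<integral>x. ?f x \<partial>\<rho>)) \<longleftrightarrow> (\<forall>P\<in>\<P>. 0 \<le> (\<integral>x. ?f x \<partial>P))"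
  proof safe
    fix P assume all: "\<forall>\<rho>\<in>measure_cone \<P>. 0 \<le> (\<integral>x. ?f x \<partial>\<rho>)" and P: "P \<in> \<P>"
    have "scale_measure (ennreal 1) P \<in> measure_cone \<P>"
      using P unfolding measure_cone_def by (intro CollectI exI[of _ 1] exI[of _ P]) simp
    with all show "0 \<le> (\<integral>x. ?f x \<partial>P)" by force
  next
    fix \<rho> assume all: "\<forall>P\<in>\<P>. 0 \<le> (\<integral>x. ?f x \<partial>P)" and "\<rho> \<in> measure_cone \<P>"
    then obtain c P where "0 \<le> c" "P \<in> \<P>" "\<rho> = scale_measure (ennreal c) P"
      by (auto simp: measure_cone_def)
    then show "0 \<le> (\<integral>x. ?f x \<partial>\<rho>)"
      using all by (simp only: integral_scale_measure[OF _ integrable_dual_constraint]) auto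
  qed
  moreover have "0 \<le> (\<integral>x. ?f x \<partial>P) \<longleftrightarrow>
      (\<integral>x. g x * indicator \<Xi> x \<partial>P) \<le>
        l \<bullet> moment_vector h P + \<mu> * (\<integral>x. indicator \<Xi> x \<partial>P)" if "P \<in> \<P>" for P
    unfolding integral_dual_constraint[OF that] by linarith
  ultimately show ?thesis
    using span by (simp add: dual_feasible_def dual_cone_def inner_vec_def)
qed

lemma dual_feasible_imp_bound:
  assumes "(l, \<mu>) \<in> dual_feasible \<Omega> \<P> h q g \<Xi>" "P \<in> moment_measures \<P> h q"
  shows "cond_expect P g \<Xi> \<le> \<mu>"
proof -
  have "P \<in> \<P>" "moment_vector h P = q" using assms(2) by (simp_all add: moment_measures_iff)
  then show ?thesis
    using assms(1) unfolding cond_expect_le_iff[OF assms(2)] dual_feasible_iff by fastforce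
qed

text \<open>
  Clearing the denominator turns a bound \<open>V\<close> on the fractional objective into the statement that
  \<open>V\<close> makes the linear objective \<open>(g - V) 1\<^sub>\<Xi>\<close> nonpositive, which is what \<open>moment_multiplier\<close>
  dualises.
\<close>

lemma dual_feasible_of_bound:
  assumes conv: "convex_measures \<P>"
    and sets: "\<And>P Q. P \<in> \<P> \<Longrightarrow> Q \<in> \<P> \<Longrightarrow> sets Q = sets P"
    and mass: "\<And>P. P \<in> \<P> \<Longrightarrow> (\<integral>x. h j0 x \<partial>P) = 1" and q: "q $ j0 = 1"
    and interior: "q \<in> interior (moment_cone \<P> h)"
    and bound: "\<And>P. P \<in> moment_measures \<P> h q \<Longrightarrow> cond_expect P g \<Xi> \<le> V"
  obtains l where "(l, V) \<in> dual_feasible \<Omega> \<P> h q g \<Xi>"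
proof -
  let ?f = "\<lambda>x. g x * indicator \<Xi> x - V * indicator \<Xi> x"
  have le: "(\<integral>x. ?f x \<partial>P) \<le> 0" if "P \<in> moment_measures \<P> h q" for P
    using that bound[OF that] by (simp add: cond_expect_le_iff integral_objective moment_measures_iff)
  obtain l where "l \<bullet> q \<le> 0" and l: "\<And>P. P \<in> \<P> \<Longrightarrow> (\<integral>x. ?f x \<partial>P) \<le> l \<bullet> moment_vector h P"
    using moment_multiplier[where f = ?f, OF conv sets integrable_h integrable_objective mass q
        interior le] by blast
  have "(\<integral>x. g x * indicator \<Xi> x \<partial>P) \<le> l \<bullet> moment_vector h P + V * (\<integral>x. indicator \<Xi> x \<partial>P)"
    if "P \<in> \<P>" for P
    using l[OF that] unfolding integral_objective[OF that] by linarith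
  then show thesis
    using \<open>l \<bullet> q \<le> 0\<close> by (intro that[of l]) (simp add: dual_feasible_iff)
qed

end

theorem theorem1:
  fixes \<Omega> \<Xi> :: "(real ^ 'n) set"
    and g :: "real ^ 'n \<Rightarrow> real"
    and h :: "'k::finite \<Rightarrow> real ^ 'n \<Rightarrow> real"
    and j0 :: 'k
    and q :: "real ^ 'k"
    and \<P>0 :: "(real ^ 'n) measure set"
  assumes "closed \<Omega>"
    and "\<Xi> \<in> sets borel" and "\<Xi> \<subseteq> \<Omega>"
    and "g \<in> borel_measurable (restrict_space borel \<Omega>)"
    and "\<And>j. h j \<in> borel_measurable (restrict_space borel \<Omega>)"
    and "\<And>x. x \<in> \<Omega> \<Longrightarrow> h j0 x = 1"
    and "q $ j0 = 1"
    and "\<P>0 \<subseteq> prob_measures_on \<Omega>"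
    and "convex_measures \<P>0"
    and "\<And>P j. P \<in> \<P>0 \<Longrightarrow> integrable P (h j)"
    and "moment_measures \<P>0 h q \<noteq> {}"
    and A1: "bounded (g ` \<Omega>)"
    and A2: "\<exists>\<epsilon>>0. (INF P \<in> moment_measures \<P>0 h q. measure P \<Xi>) \<ge> \<epsilon>"
    and A3: "q \<in> interior (moment_cone \<P>0 h)"
  shows "\<bar>primal_value \<P>0 h q g \<Xi>\<bar> \<noteq> \<infinity> \<and>
         primal_value \<P>0 h q g \<Xi> = dual_value \<Omega> \<P>0 h q g \<Xi>"
proof -
  let ?R = "restrict_space borel \<Omega> :: (real ^ 'n) measure"
  obtain B where B: "\<And>x. x \<in> \<Omega> \<Longrightarrow> \<bar>g x\<bar> \<le> B" "0 \<le> B"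
    using A1 by (auto simp: bounded_pos intro: less_imp_le)
  obtain \<epsilon> where "0 < \<epsilon>" and \<epsilon>: "\<epsilon> \<le> (INF P \<in> moment_measures \<P>0 h q. measure P \<Xi>)"
    using A2 by auto
  have P0: "prob_space P" "sets P = sets ?R" "space P = \<Omega>" if "P \<in> \<P>0" for P
    using that \<open>\<P>0 \<subseteq> prob_measures_on \<Omega>\<close> sets_eq_imp_space_eq[of P ?R]
    by (auto simp: prob_measures_on_def space_restrict_space)
  have \<Xi>: "\<Xi> \<in> sets P" if "P \<in> \<P>0" for P
    using \<open>\<Xi> \<in> sets borel\<close> \<open>\<Xi> \<subseteq> \<Omega>\<close> P0(2)[OF that] \<open>closed \<Omega>\<close> by (simp add: sets_restrict_space_iff)
  have ind: "integrable P (indicator \<Xi> :: real ^ 'n \<Rightarrow> real)"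
    and prob: "(\<integral>x. indicator \<Xi> x \<partial>P) = measure P \<Xi>" if "P \<in> \<P>0" for P
  proof -
    interpret prob_space P by (rule P0(1)[OF that])
    show "integrable P (indicator \<Xi> :: real ^ 'n \<Rightarrow> real)" using \<Xi>[OF that] by (simp add: emeasure_eq_measure)
    show "(\<integral>x. indicator \<Xi> x \<partial>P) = measure P \<Xi>" using \<Xi>[OF that] by simp
  qed
  have g_ind: "integrable P (\<lambda>x. g x * indicator \<Xi> x)" if "P \<in> \<P>0" for P
  proof (rule Bochner_Integration.integrable_bound)
    show "integrable P (\<lambda>x. B * indicator \<Xi> x)" using ind[OF that] by simp
    have "g \<in> borel_measurable P"
      using \<open>g \<in> borel_measurable ?R\<close> by (simp add: measurable_cong_sets[OF P0(2)[OF that] refl])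
    then show "(\<lambda>x. g x * indicator \<Xi> x) \<in> borel_measurable P"
      using \<Xi>[OF that] by simp
    show "AE x in P. norm (g x * indicator \<Xi> x) \<le> norm (B * indicator \<Xi> x)"
      using B P0(3)[OF that] by (auto simp: indicator_def)
  qed
  have prob_ge: "\<epsilon> \<le> measure P \<Xi>" if "P \<in> moment_measures \<P>0 h q" for P
    by (rule order_trans[OF \<epsilon>], rule cINF_lower) (use that in \<open>auto intro: bdd_belowI2[of _ 0]\<close>)
  interpret conditional_moment_problem \<Omega> \<Xi> g h q \<P>0
  proof
    show "0 < (\<integral>x. indicator \<Xi> x \<partial>P :: real)" if "P \<in> moment_measures \<P>0 h q" for P
      using prob_ge[OF that] \<open>0 < \<epsilon>\<close> prob[of P] that by (simp add: moment_measures_iff)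
  qed (fact assms(10) ind g_ind)+
  \<comment> \<open>A bound for \<open>g\<close> bounds its conditional averages; this keeps the primal value finite.\<close>
  have upper: "cond_expect P g \<Xi> \<le> B" if "P \<in> moment_measures \<P>0 h q" for P
  proof -
    have P: "P \<in> \<P>0" using that by (simp add: moment_measures_iff)
    have "(\<integral>x. g x * indicator \<Xi> x \<partial>P) \<le> (\<integral>x. B * indicator \<Xi> x \<partial>P)"
      using B P0(3)[OF P] by (intro integral_mono g_ind integrable_mult_right ind P)
        (auto simp: indicator_def abs_le_iff)
    then show ?thesis unfolding cond_expect_le_iff[OF that] by simp
  qed
  define V where "V = (SUP P \<in> moment_measures \<P>0 h q. cond_expect P g \<Xi>)"
  have bdd: "bdd_above ((\<lambda>P. cond_expect P g \<Xi>) ` moment_measures \<P>0 h q)"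
    using upper by (rule bdd_aboveI2)
  have le_V: "cond_expect P g \<Xi> \<le> V" if "P \<in> moment_measures \<P>0 h q" for P
    unfolding V_def using bdd that by (rule cSUP_upper2) simp
  have primal: "primal_value \<P>0 h q g \<Xi> = ereal V"
    unfolding primal_value_def
  proof (rule antisym)
    show "(SUP P \<in> moment_measures \<P>0 h q. ereal (cond_expect P g \<Xi>)) \<le> ereal V"
      using le_V by (intro SUP_least) simp
    show "ereal V \<le> (SUP P \<in> moment_measures \<P>0 h q. ereal (cond_expect P g \<Xi>))"
    proof (rule ereal_le_epsilon2)
      fix e :: real assume "0 < e"
      then obtain P where P: "P \<in> moment_measures \<P>0 h q" "V - e < cond_expect P g \<Xi>"
        using less_cSUP_iff[OF assms(11) bdd, of "V - e"] by (auto simp: V_def)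
      have "ereal V \<le> ereal (cond_expect P g \<Xi>) + ereal e" using P(2) by simp
      also have "\<dots> \<le> (SUP P \<in> moment_measures \<P>0 h q. ereal (cond_expect P g \<Xi>)) + ereal e"
        using P(1) by (intro add_right_mono SUP_upper)
      finally show "ereal V \<le> (SUP P \<in> moment_measures \<P>0 h q. ereal (cond_expect P g \<Xi>)) + ereal e" .
    qed
  qed
  have mass: "(\<integral>x. h j0 x \<partial>P) = 1" if "P \<in> \<P>0" for P
  proof -
    interpret prob_space P by (rule P0(1)[OF that])
    have "(\<integral>x. h j0 x \<partial>P) = (\<integral>x. 1 \<partial>P)"
      using assms(6) P0(3)[OF that] by (intro Bochner_Integration.integral_cong) auto
    then show ?thesis by (simp add: prob_space)
  qed
  have same_sets: "sets Q = sets P" if "P \<in> \<P>0" "Q \<in> \<P>0" for P Q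
    using that P0(2) by simp
  \<comment> \<open>The supremum \<open>V\<close> is itself a dual value, although it may not be attained in the primal.\<close>
  obtain l where "(l, V) \<in> dual_feasible \<Omega> \<P>0 h q g \<Xi>"
    using dual_feasible_of_bound[OF \<open>convex_measures \<P>0\<close> same_sets mass \<open>q $ j0 = 1\<close> A3 le_V] .
  then have "dual_value \<Omega> \<P>0 h q g \<Xi> \<le> ereal V"
    unfolding dual_value_def by (intro INF_lower2[of "(l, V)"]) auto
  moreover have "ereal V \<le> dual_value \<Omega> \<P>0 h q g \<Xi>"
    unfolding dual_value_def V_def
    using assms(11) by (auto intro!: INF_greatest cSUP_least intro: dual_feasible_imp_bound)
  ultimately show ?thesis
    unfolding primal by (simp add: antisym)
qed

end
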